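(* Let $(a_n)_{n\ge0}$ be the sequence, listed in increasing order, of the non-negative integers $m$ such that $840m+1$ is a perfect square. Then $$\sum_{n=0}^\infty(-1)^{\lfloor (n+4)/8\rfloor}q^{a_n}=\frac{(q^3,q^4,q^7;q^7)_\infty}{(q,q^4;q^5)_\infty}.$$
   Context: Here $q$ is a complex number with $|q|<1$ (equivalently, the identity may be read as an identity of formal power series in $q$). For a complex number $a$, $(a;q)_\infty:=\prod_{i=0}^\infty(1-aq^i)$, and $(a_1,a_2,\dots,a_m;q)_\infty:=\prod_{j=1}^m(a_j;q)_\infty$. $\lfloor x\rfloor$ is the floor function. *)

theory Defs
  imports "HOL-Analysis.Analysis" "HOL-Computational_Algebra.Nth_Powers"
begin

definition qpoch_inf :: "complex \<Rightarrow> complex \<Rightarrow> complex" where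
  "qpoch_inf a q = (\<Prod>i. 1 - a * q ^ i)"

definition qpochs_inf :: "complex list \<Rightarrow> complex \<Rightarrow> complex" where
  "qpochs_inf as q = (\<Prod>a\<leftarrow>as. qpoch_inf a q)"

definition square_index_set :: "nat set" where
  "square_index_set = {m. is_nth_power 2 (840 * m + 1)}"

definition square_index_seq :: "nat \<Rightarrow> nat" where
  "square_index_seq = enumerate square_index_set"

text \<open>Both \<^const>\<open>prodinf\<close> and \<^const>\<open>enumerate\<close> are total, and meaningful only for a
  convergent product and an infinite set respectively; the next two lemmas rule out the
  degenerate cases.\<close>

lemma convergent_prod_qpoch_inf:
  fixes a q :: complex
  assumes "norm q < 1"
  shows "convergent_prod (\<lambda>i. 1 - a * q ^ i)"
proof -
  have "summable (\<lambda>i. norm (a * q ^ i))"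
    using assms by (simp add: norm_mult norm_power summable_mult)
  then have "abs_convergent_prod (\<lambda>i. 1 - a * q ^ i)"
    by (simp add: abs_convergent_prod_conv_summable)
  then show ?thesis
    by (rule abs_convergent_prod_imp_convergent_prod)
qed

lemma infinite_square_index_set: "infinite square_index_set"
proof -
  have "840 * (j * (840 * j + 2)) + 1 = (840 * j + 1)\<^sup>2" for j :: nat
    by (simp add: power2_eq_square algebra_simps)
  then have "range (\<lambda>j::nat. j * (840 * j + 2)) \<subseteq> square_index_set"
    unfolding square_index_set_def by (auto intro: is_nth_powerI)
  moreover have "strict_mono (\<lambda>j::nat. j * (840 * j + 2))"
    by (rule strict_monoI_Suc) (simp add: algebra_simps)
  then have "infinite (range (\<lambda>j::nat. j * (840 * j + 2)))"
    by (simp add: range_inj_infinite strict_mono_imp_inj_on)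
  ultimately show ?thesis
    using finite_subset by blast
qed

end

theory Submission
  imports Defs
begin

text \<open>By the Jacobi triple product, with \<open>q = x^840\<close>, the products \<open>(q\<^sup>2,q\<^sup>3,q\<^sup>5;q\<^sup>5)\<close>,
  \<open>(q\<^sup>3,q\<^sup>4,q\<^sup>7;q\<^sup>7)\<close> and \<open>(q;q)\<close> are, up to powers of \<open>x\<close>, the theta series of
  \<open>21A\<^sup>2\<close>, \<open>15B\<^sup>2\<close> and \<open>35C\<^sup>2\<close> over \<open>A = 10k + 1\<close>, \<open>B = 14n + 1\<close>, \<open>C = 6m + 1\<close>, and the
  left-hand side is a theta series of \<open>D\<^sup>2\<close> over the \<open>D\<close> with \<open>D\<^sup>2 \<equiv> 1 (mod 840)\<close>. Since \<open>(q;q)\<close> is the product of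
  \<open>(q,q\<^sup>4;q\<^sup>5)\<close> and \<open>(q\<^sup>2,q\<^sup>3,q\<^sup>5;q\<^sup>5)\<close>, the claim becomes an identity between signed sums of
  \<open>x^(21A\<^sup>2 + 15B\<^sup>2)\<close> and \<open>x^(35C\<^sup>2 + D\<^sup>2)\<close>. Both
  \<open>(C, D) = ((A + B)/2, (7A - 5B)/2)\<close> and \<open>(C, D) = ((A - B)/2, (7A + 5B)/2)\<close> carry one form to the
  other; using the first when \<open>k + n\<close> is even and the second when it is odd matches the
  \<open>(A, B)\<close>-sum with part of the \<open>(C, D)\<close>-sum, once the latter is enlarged by pairs divisible by 3,
  which cancel under \<open>C \<mapsto> -C\<close>. The remaining part of the \<open>(C, D)\<close>-sum vanishes: an isometry of
  \<open>35C\<^sup>2 + D\<^sup>2\<close> exchanges its positive and its negative terms.\<close>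

section \<open>The Jacobi triple product\<close>

definition qfact :: "complex \<Rightarrow> nat \<Rightarrow> complex" where
  "qfact p n = (\<Prod>i<n. 1 - p ^ Suc i)"

definition qbinom :: "complex \<Rightarrow> nat \<Rightarrow> nat \<Rightarrow> complex" where
  "qbinom p n k = (if k \<le> n then qfact p n / (qfact p k * qfact p (n - k)) else 0)"

lemma qfact_0 [simp]: "qfact p 0 = 1"
  by (simp add: qfact_def)

lemma qfact_Suc: "qfact p (Suc n) = qfact p n * (1 - p ^ Suc n)"
  by (simp add: qfact_def)

lemma one_minus_mult_power_nonzero:
  fixes a p :: complex
  assumes "norm p < 1" "norm a < 1"
  shows "1 - a * p ^ n \<noteq> 0"
proof
  assume "1 - a * p ^ n = 0"
  then have "norm (a * p ^ n) = 1"
    by (metis eq_iff_diff_eq_0 norm_one)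
  moreover have "norm (a * p ^ n) < 1"
    using assms by (metis le_less_trans less_eq_real_def mult_left_le norm_ge_zero norm_mult
        norm_power power_le_one)
  ultimately show False
    by simp
qed

lemma qfact_nonzero:
  assumes "norm p < 1"
  shows "qfact p n \<noteq> 0"
  using one_minus_mult_power_nonzero[OF assms assms] by (simp add: qfact_def)

text \<open>The q-Pascal rule. With \<open>n = k + m + 1\<close> and denominators cleared it is
  \<open>(1 - p^(m+1)) + p^(m+1) * (1 - p^(k+1)) = 1 - p^(n+1)\<close>.\<close>

lemma qbinom_Suc_Suc:
  assumes "norm p < 1" "k \<le> n"
  shows "qbinom p (Suc n) (Suc k) = qbinom p n (Suc k) + p ^ (n - k) * qbinom p n k"
proof (cases "k = n")
  case True
  \<comment> \<open>Here \<open>qbinom p n (Suc k)\<close> has the default value 0 and the other two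
    coefficients are 1.\<close>
  then show ?thesis
    using qfact_nonzero[OF assms(1)] by (simp add: qbinom_def)
next
  case False
  then obtain m where m: "n = Suc (k + m)"
    using assms(2) by (metis le_neq_implies_less less_imp_Suc_add)
  define A B where "A = qfact p k" and "B = qfact p m"
  have nz: "A \<noteq> 0" "B \<noteq> 0" "1 - p ^ Suc k \<noteq> 0" "1 - p ^ Suc m \<noteq> 0"
    using qfact_nonzero[OF assms(1)] one_minus_mult_power_nonzero[OF assms(1) assms(1)]
    by (simp_all add: A_def B_def)
  have "qbinom p n (Suc k) + p ^ (n - k) * qbinom p n k =
      qfact p n * (1 / (A * (1 - p ^ Suc k) * B) + p ^ Suc m / (A * (B * (1 - p ^ Suc m))))"
    by (simp add: qbinom_def m qfact_Suc[of p k] qfact_Suc[of p m] A_def B_def Suc_diff_le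
        distrib_left del: power_Suc)
  also have "1 / (A * (1 - p ^ Suc k) * B) + p ^ Suc m / (A * (B * (1 - p ^ Suc m))) =
      (1 - p ^ Suc m * p ^ Suc k) / (A * (1 - p ^ Suc k) * (B * (1 - p ^ Suc m)))"
    using nz by (simp add: divide_simps del: power_Suc) (simp add: algebra_simps)
  also have "p ^ Suc m * p ^ Suc k = p ^ Suc n"
    by (simp add: m power_add)
  also have "qfact p n * ((1 - p ^ Suc n) / (A * (1 - p ^ Suc k) * (B * (1 - p ^ Suc m)))) =
      qbinom p (Suc n) (Suc k)"
    by (simp add: qbinom_def m qfact_Suc A_def B_def Suc_diff_le del: power_Suc)
  finally show ?thesis ..
qed

text \<open>Induction on \<open>n\<close>: the new factor \<open>1 - x * p ^ n\<close> changes the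
  coefficients by the q-Pascal rule, since \<open>k(k-1)/2\<close> grows by \<open>k\<close> when
  \<open>k\<close> becomes \<open>k + 1\<close>, and
  \<open>p ^ k * p ^ (n - k) = p ^ n\<close>.\<close>

lemma qbinomial_theorem:
  assumes "norm p < 1"
  shows "(\<Prod>i<n. 1 - x * p ^ i) =
    (\<Sum>k\<le>n. (-1) ^ k * p ^ (k * (k - 1) div 2) * qbinom p n k * x ^ k)"
proof (induction n)
  case 0
  then show ?case
    by (simp add: qbinom_def)
next
  case (Suc n)
  define a where "a n k = (-1) ^ k * p ^ (k * (k - 1) div 2) * qbinom p n k * x ^ k" for n k
  have step: "a (Suc n) (Suc k) = a n (Suc k) - a n k * (x * p ^ n)" if "k \<le> n" for k
  proof -
    have tri: "Suc k * (Suc k - 1) div 2 = k * (k - 1) div 2 + k"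
    proof -
      have "Suc k * (Suc k - 1) = k * (k - 1) + k * 2"
        by (cases k) auto
      then show ?thesis
        by simp
    qed
    have "p ^ n = p ^ k * p ^ (n - k)"
      using that by (simp flip: power_add)
    then show ?thesis
      unfolding a_def qbinom_Suc_Suc[OF assms that] tri
      by (simp add: power_add algebra_simps)
  qed
  have "(\<Prod>i<Suc n. 1 - x * p ^ i) = (\<Sum>k\<le>n. a n k) * (1 - x * p ^ n)"
    using Suc by (simp add: a_def)
  \<comment> \<open>The first sum may run to \<open>Suc n\<close> because
    \<open>qbinom p n (Suc n) = 0\<close>.\<close>
  also have "\<dots> = (\<Sum>k\<le>Suc n. a n k) - (\<Sum>k\<le>n. a n k * (x * p ^ n))"
    by (simp add: a_def qbinom_def right_diff_distrib sum_distrib_right)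
  also have "\<dots> = a n 0 + (\<Sum>k\<le>n. a (Suc n) (Suc k))"
    by (simp add: sum.atMost_Suc_shift step sum_subtractf del: sum.atMost_Suc)
  also have "a n 0 = a (Suc n) 0"
    using qfact_nonzero[OF assms] by (simp add: a_def qbinom_def)
  also have "a (Suc n) 0 + (\<Sum>k\<le>n. a (Suc n) (Suc k)) = (\<Sum>k\<le>Suc n. a (Suc n) k)"
    by (simp add: sum.atMost_Suc_shift del: sum.atMost_Suc)
  finally show ?case
    by (simp add: a_def)
qed

section \<open>The finite form of the triple product\<close>

definition theta_term :: "complex \<Rightarrow> complex \<Rightarrow> int \<Rightarrow> complex" where
  "theta_term z p j = (-1) powi j * z powi j * p powi (j * (j - 1) div 2)"

text \<open>Makes the \<open>div 2\<close> in the exponent of \<open>theta_term\<close> exact, also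
  for negative \<open>j\<close>.\<close>

lemma even_int_mult_pred: "even (j * (j - 1))" for j :: int
  by auto

text \<open>The q-binomial theorem with \<open>2 * n\<close> factors at
  \<open>x = z / p ^ n\<close>, its index shifted by \<open>n\<close>. The upper \<open>n\<close>
  factors are \<open>1 - z * p ^ i\<close>; the lower ones, read backwards, are multiples of
  \<open>1 - p / z * p ^ i\<close>.\<close>

lemma finite_jacobi_triple_product:
  assumes "norm p < 1" "p \<noteq> 0" "z \<noteq> 0"
  shows "(\<Prod>i<n. 1 - z * p ^ i) * (\<Prod>i<n. 1 - p / z * p ^ i) =
    (\<Sum>j\<in>{-int n..int n}. theta_term z p j * qbinom p (2 * n) (nat (j + int n)))"
proof -
  define x where "x = z / p ^ n"
  \<comment> \<open>\<open>t\<close> collects the factors \<open>-z / p ^ Suc i\<close> extracted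
    from the lower half; it reappears on the right-hand side and cancels.\<close>
  define t where "t = (-z) ^ n / p powi (int n * (int n + 1) div 2)"
  have t: "t \<noteq> 0"
    using assms by (simp add: t_def)
  have "(\<Prod>i<n. 1 - x * p ^ i) = (\<Prod>i<n. 1 - x * p ^ (n - Suc i))"
    by (rule prod.nat_diff_reindex[symmetric])
  also have "\<dots> = (\<Prod>i<n. (1 - p / z * p ^ i) * (-z / p ^ Suc i))"
  proof (rule prod.cong)
    fix i assume "i \<in> {..<n}"
    then have "p ^ n = p ^ (n - Suc i) * p ^ Suc i"
      by (metis Suc_leI le_add_diff_inverse2 lessThan_iff power_add)
    then show "1 - x * p ^ (n - Suc i) = (1 - p / z * p ^ i) * (-z / p ^ Suc i)"
      using assms unfolding x_def by (simp add: field_simps)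
  qed simp
  also have "\<dots> = (\<Prod>i<n. 1 - p / z * p ^ i) * (\<Prod>i<n. -z / p ^ Suc i)"
    by (rule prod.distrib)
  also have "(\<Prod>i<n. -z / p ^ Suc i) = t"
    unfolding t_def
  proof (induction n)
    case (Suc n)
    have "int (Suc n) * (int (Suc n) + 1) = int n * (int n + 1) + int (Suc n) * 2"
      by (simp add: algebra_simps)
    then have "int (Suc n) * (int (Suc n) + 1) div 2 = int n * (int n + 1) div 2 + int (Suc n)"
      by simp
    then have "p powi (int (Suc n) * (int (Suc n) + 1) div 2) =
        p powi (int n * (int n + 1) div 2) * p ^ Suc n"
      using assms(2) by (simp add: power_int_add flip: power_int_of_nat)
    then show ?case
      using Suc by simp
  qed simp
  finally have low: "(\<Prod>i<n. 1 - x * p ^ i) = (\<Prod>i<n. 1 - p / z * p ^ i) * t" .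
  have "(\<Prod>i<2*n. 1 - x * p ^ i) = (\<Prod>i<n. 1 - x * p ^ i) * (\<Prod>i<n. 1 - x * p ^ (n + i))"
  proof -
    have "{..<2*n} = {..<n} \<union> {n..<n+n}"
      by auto
    then show ?thesis
      using prod.shift_bounds_nat_ivl[of "\<lambda>i. 1 - x * p ^ i" 0 n n]
      by (simp add: prod.union_disjoint ivl_disj_int add.commute atLeast0LessThan)
  qed
  also have "(\<Prod>i<n. 1 - x * p ^ (n + i)) = (\<Prod>i<n. 1 - z * p ^ i)"
    using assms by (simp add: x_def power_add)
  finally have "t * ((\<Prod>i<n. 1 - z * p ^ i) * (\<Prod>i<n. 1 - p / z * p ^ i)) =
      (\<Prod>i<2*n. 1 - x * p ^ i)"
    by (simp add: low)
  also have "\<dots> = (\<Sum>k\<le>2*n. (-1) ^ k * p ^ (k * (k - 1) div 2) * qbinom p (2*n) k * x ^ k)"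
    by (rule qbinomial_theorem) fact
  also have "\<dots> = (\<Sum>j\<in>{-int n..int n}. t * (theta_term z p j * qbinom p (2 * n) (nat (j + int n))))"
  proof (rule sum.reindex_bij_witness[of _ "\<lambda>j. nat (j + int n)" "\<lambda>k. int k - int n"])
    fix k assume "k \<in> {..2*n}"
    define j where "j = int k - int n"
    have "int (k * (k - 1) div 2) = int k * (int k - 1) div 2"
      by (cases k) (simp_all add: zdiv_int algebra_simps)
    moreover have "int k * (int k - 1) = j * (j - 1) - int n * (int n + 1) + int n * int k * 2"
      by (simp add: j_def algebra_simps)
    moreover have "(j * (j - 1) - int n * (int n + 1) + int n * int k * 2) div 2 =
        j * (j - 1) div 2 - int n * (int n + 1) div 2 + int n * int k"
      using even_int_mult_pred[of j] even_int_mult_pred[of "int n + 1"]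
      by (simp add: mult.commute)
    \<comment> \<open>The term \<open>int n * int k\<close> cancels against the denominator of
      \<open>x ^ k\<close>, and \<open>n(n+1)/2\<close> goes into \<open>t\<close>.\<close>
    ultimately have e: "int (k * (k - 1) div 2) =
        j * (j - 1) div 2 - int n * (int n + 1) div 2 + int n * int k"
      by simp
    have P: "p ^ (k * (k - 1) div 2) =
        p powi (j * (j - 1) div 2) / p powi (int n * (int n + 1) div 2) * (p ^ n) ^ k"
    proof -
      have "p ^ (k * (k - 1) div 2) = p powi (int (k * (k - 1) div 2))"
        by simp
      also have "\<dots> = p powi (j * (j - 1) div 2) / p powi (int n * (int n + 1) div 2) * p powi (int (n * k))"
        unfolding e using assms by (simp add: power_int_add power_int_diff)
      also have "p powi (int (n * k)) = (p ^ n) ^ k"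
        by (simp only: power_int_of_nat power_mult)
      finally show ?thesis .
    qed
    have Z: "z ^ k = z powi j * z ^ n" "(-1) ^ k = (-1) powi j * (-1 :: complex) ^ n"
      using assms by (simp_all add: j_def power_int_diff)
    have "(-1) ^ k * p ^ (k * (k - 1) div 2) * qbinom p (2*n) k * x ^ k =
        t * (theta_term z p j * qbinom p (2 * n) k)"
      unfolding P x_def power_divide Z t_def theta_term_def using assms
      by (simp add: field_simps power_minus[of z])
    then show "t * (theta_term z p (int k - int n) * qbinom p (2 * n) (nat (int k - int n + int n))) =
        (-1) ^ k * p ^ (k * (k - 1) div 2) * qbinom p (2*n) k * x ^ k"
      unfolding j_def by auto
  qed auto
  finally show ?thesis
    using t by (simp flip: sum_distrib_left)
qed

section \<open>Products of unconditional sums and Tannery's theorem\<close>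

lemma has_sum_mult_complex:
  fixes f :: "'a \<Rightarrow> complex" and g :: "'b \<Rightarrow> complex"
  assumes f: "(f has_sum a) A" and g: "(g has_sum b) B"
  shows "((\<lambda>(x, y). f x * g y) has_sum a * b) (A \<times> B)"
proof (rule has_sum_SigmaI)
  show "((\<lambda>y. case (x, y) of (x, y) \<Rightarrow> f x * g y) has_sum f x * b) B" for x
    using has_sum_cmult_right[OF g, of "f x"] by simp
  show "((\<lambda>x. f x * b) has_sum a * b) A"
    by (rule has_sum_cmult_left[OF f])
  \<comment> \<open>A summable complex family is absolutely summable, and this is what makes the
    double family summable.\<close>
  have nf: "(\<lambda>x. norm (f x)) summable_on A" and ng: "(\<lambda>y. norm (g y)) summable_on B"
    using f g by (simp_all add: has_sum_imp_summable flip: summable_on_iff_abs_summable_on_complex)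
  have "(\<lambda>(x, y). norm (f x) * norm (g y)) summable_on (A \<times> B)"
  proof (rule summable_on_SigmaI)
    show "((\<lambda>y. case (x, y) of (x, y) \<Rightarrow> norm (f x) * norm (g y)) has_sum
        norm (f x) * infsum (\<lambda>y. norm (g y)) B) B" for x
      using has_sum_cmult_right[OF has_sum_infsum[OF ng], of "norm (f x)"] by simp
  qed (use nf in \<open>auto intro: summable_on_cmult_left\<close>)
  then have "(\<lambda>p. norm (case p of (x, y) \<Rightarrow> f x * g y)) summable_on (A \<times> B)"
    by (simp add: case_prod_unfold norm_mult)
  then show "(\<lambda>(x, y). f x * g y) summable_on (A \<times> B)"
    by (rule abs_summable_summable)
qed

text \<open>Tannery's theorem, as dominated convergence for the counting measure; the finite
  supports turn the integrals of \<open>s n\<close> into finite sums.\<close>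

lemma has_sum_dominated_limit:
  fixes f :: "'a \<Rightarrow> complex" and s :: "nat \<Rightarrow> 'a \<Rightarrow> complex"
  assumes w: "w summable_on UNIV"
    and bound: "\<And>n x. norm (s n x) \<le> w x"
    and lim: "\<And>x. (\<lambda>n. s n x) \<longlonglongrightarrow> f x"
    and fin: "\<And>n. finite (F n)" "\<And>n x. x \<notin> F n \<Longrightarrow> s n x = 0"
    and L: "(\<lambda>n. \<Sum>x\<in>F n. s n x) \<longlonglongrightarrow> L"
  shows "(f has_sum L) UNIV"
proof -
  have w0: "w x \<ge> 0" for x
    using bound[of 0 x] norm_ge_zero order_trans by blast
  then have w': "integrable (count_space UNIV) w"
    using w abs_summable_equivalent[of w UNIV] by (simp add: abs_summable_on_def)
  have f_int: "integrable (count_space UNIV) f"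
    and conv: "(\<lambda>n. lebesgue_integral (count_space UNIV) (s n)) \<longlonglongrightarrow>
      lebesgue_integral (count_space UNIV) f"
    using lim bound
    by (auto intro!: integrable_dominated_convergence[OF _ _ w', of f s]
        integral_dominated_convergence[OF _ _ w', of f s])
  have "lebesgue_integral (count_space UNIV) (s n) = (\<Sum>x\<in>F n. s n x)" for n
    using fin by (intro lebesgue_integral_count_space_finite_support[THEN trans]
        sum.mono_neutral_left) (auto intro: finite_subset[OF _ fin(1)[of n]])
  then have "lebesgue_integral (count_space UNIV) f = L"
    using conv L LIMSEQ_unique by simp
  then have "infsum f UNIV = L"
    using f_int infsetsum_infsum[of f UNIV] by (simp add: abs_summable_on_def infsetsum_def)
  moreover have "f summable_on UNIV"
    using f_int abs_summable_equivalent[of f UNIV]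
    by (simp add: abs_summable_on_def abs_summable_summable)
  ultimately show ?thesis
    by (simp add: has_sum_iff)
qed

section \<open>The limit of the finite triple product\<close>

lemma qpoch_inf_tendsto:
  assumes "norm p < 1"
  shows "(\<lambda>n. \<Prod>i<n. 1 - a * p ^ i) \<longlonglongrightarrow> qpoch_inf a p"
  unfolding qpoch_inf_def
  by (rule has_prod_imp_tendsto' convergent_prod_has_prod convergent_prod_qpoch_inf assms)+

lemma qpoch_inf_nonzero:
  assumes "norm p < 1" "norm a < 1"
  shows "qpoch_inf a p \<noteq> 0"
  unfolding qpoch_inf_def
  by (rule prodinf_nonzero convergent_prod_qpoch_inf one_minus_mult_power_nonzero assms)+

lemma qfact_tendsto:
  assumes "norm p < 1"
  shows "qfact p \<longlonglongrightarrow> qpoch_inf p p"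
  using qpoch_inf_tendsto[OF assms, of p] by (simp add: qfact_def[abs_def])

text \<open>\<open>qfact p\<close> and its reciprocal both converge, the limit
  \<open>qpoch_inf p p\<close> being nonzero, hence both are bounded. The bound is uniform in
  \<open>n\<close> and \<open>k\<close>, as domination requires.\<close>

lemma qbinom_bounded:
  assumes "norm p < 1"
  obtains K where "K \<ge> 0" "\<And>n k. norm (qbinom p n k) \<le> K"
proof -
  note lim = qfact_tendsto[OF assms]
  have "Bseq (qfact p)"
    using lim by (intro convergent_imp_Bseq convergentI)
  then obtain A where A: "A > 0" "\<And>n. norm (qfact p n) \<le> A"
    by (auto simp: Bseq_def)
  have "(\<lambda>n. inverse (qfact p n)) \<longlonglongrightarrow> inverse (qpoch_inf p p)"
    using lim qpoch_inf_nonzero[OF assms assms] by (rule tendsto_inverse)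
  then have "Bseq (\<lambda>n. inverse (qfact p n))"
    by (intro convergent_imp_Bseq convergentI)
  then obtain B where B: "B > 0" "\<And>n. norm (inverse (qfact p n)) \<le> B"
    by (auto simp: Bseq_def)
  have "norm (qbinom p n k) \<le> A * (B * B)" for n k
  proof (cases "k \<le> n")
    case True
    have "norm (qbinom p n k) =
        norm (qfact p n) * (norm (inverse (qfact p k)) * norm (inverse (qfact p (n - k))))"
      using True by (simp add: qbinom_def norm_divide norm_mult norm_inverse field_simps)
    also have "\<dots> \<le> A * (B * B)"
      using A B by (intro mult_mono) (auto intro: less_imp_le)
    finally show ?thesis .
  qed (use A B in \<open>simp add: qbinom_def\<close>)
  then show ?thesis
    using that[of "A * (B * B)"] A B by simp
qed

text \<open>Lets terms of negative index be treated as terms of positive index for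
  \<open>p / z\<close>.\<close>

lemma theta_term_minus:
  assumes "p \<noteq> 0" "z \<noteq> 0"
  shows "theta_term z p (- j) = theta_term (p / z) p j"
proof -
  have "- j * (- j - 1) = j * (j - 1) + j * 2"
    by (simp add: algebra_simps)
  then have "- j * (- j - 1) div 2 = j * (j - 1) div 2 + j"
    by simp
  moreover have "(-1 :: complex) powi (- j) = (-1) powi j"
    by (simp add: power_int_minus_left)
  ultimately show ?thesis
    using assms by (simp add: theta_term_def power_int_add power_int_minus power_int_divide_distrib
        field_simps)
qed

text \<open>The ratio of consecutive terms is \<open>- z * p ^ n\<close>, which tends to 0.\<close>

lemma summable_theta_term_of_nat:
  assumes "norm p < 1" "p \<noteq> 0" "z \<noteq> 0"
  shows "summable (\<lambda>n. norm (theta_term z p (int n)))"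
proof -
  have "(\<lambda>n. norm z * norm p ^ n) \<longlonglongrightarrow> norm z * 0"
    using assms by (intro tendsto_intros LIMSEQ_realpow_zero) auto
  then have "eventually (\<lambda>n. norm z * norm p ^ n < 1 / 2) sequentially"
    by (intro order_tendstoD) auto
  then obtain N where N: "\<And>n. n \<ge> N \<Longrightarrow> norm z * norm p ^ n < 1 / 2"
    by (auto simp: eventually_at_top_linorder)
  show ?thesis
  proof (rule summable_ratio_test[of "1/2" N])
    fix n assume n: "n \<ge> N"
    have "int (Suc n) * (int (Suc n) - 1) = int n * (int n - 1) + int n * 2"
      by (simp add: algebra_simps)
    then have "int (Suc n) * (int (Suc n) - 1) div 2 = int n * (int n - 1) div 2 + int n"
      by simp
    then have "theta_term z p (int (Suc n)) = - z * p ^ n * theta_term z p (int n)"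
      using assms by (simp add: theta_term_def power_int_add)
    then have "norm (theta_term z p (int (Suc n))) =
        norm z * norm p ^ n * norm (theta_term z p (int n))"
      by (simp add: norm_mult norm_power)
    also have "\<dots> \<le> 1 / 2 * norm (theta_term z p (int n))"
      using N[OF n] by (intro mult_right_mono) auto
    finally show "norm (norm (theta_term z p (int (Suc n)))) \<le>
        1 / 2 * norm (norm (theta_term z p (int n)))"
      by simp
  qed simp
qed

lemma abs_summable_theta_term:
  assumes "norm p < 1" "p \<noteq> 0" "z \<noteq> 0"
  shows "(\<lambda>j. norm (theta_term z p j)) summable_on UNIV"
proof -
  have "(\<lambda>j. norm (theta_term z p j)) summable_on range int"
    using summable_theta_term_of_nat[OF assms]
    by (subst summable_on_reindex) (auto simp: o_def intro!: norm_summable_imp_summable_on)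
  moreover have "(\<lambda>j. norm (theta_term z p j)) summable_on range (\<lambda>n. - int n)"
    using summable_theta_term_of_nat[of p "p / z"] assms
    by (subst summable_on_reindex)
      (auto simp: o_def theta_term_minus inj_on_def intro!: norm_summable_imp_summable_on)
  moreover have "UNIV = range int \<union> range (\<lambda>n. - int n)"
    by (auto simp: image_iff) (metis int_cases2)
  ultimately show ?thesis
    by (metis summable_on_union)
qed

text \<open>For fixed \<open>j\<close>, \<open>qbinom p (2 * n) (nat (j + int n))\<close> tends to
  \<open>1 / qpoch_inf p p\<close>, and Tannery's theorem takes the limit of the finite identity
  termwise.\<close>

theorem jacobi_triple_product:
  assumes p: "norm p < 1" "p \<noteq> 0" and z: "z \<noteq> 0"
  shows "(theta_term z p has_sum qpoch_inf z p * qpoch_inf (p / z) p * qpoch_inf p p) UNIV"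
proof -
  note nz = qpoch_inf_nonzero[OF p(1) p(1)]
  obtain K where K: "K \<ge> 0" "\<And>n k. norm (qbinom p n k) \<le> K"
    using qbinom_bounded[OF p(1)] by blast
  define s where "s n j = (if j \<in> {-int n..int n}
    then theta_term z p j * qbinom p (2 * n) (nat (j + int n)) else 0)" for n j
  have "((\<lambda>j. theta_term z p j / qpoch_inf p p) has_sum qpoch_inf z p * qpoch_inf (p / z) p) UNIV"
  proof (rule has_sum_dominated_limit[where s = s and F = "\<lambda>n. {-int n..int n}"])
    show "(\<lambda>j. norm (theta_term z p j) * K) summable_on UNIV"
      by (intro summable_on_cmult_left abs_summable_theta_term assms)
    show "norm (s n j) \<le> norm (theta_term z p j) * K" for n j
      using K by (auto simp: s_def norm_mult intro!: mult_left_mono)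
    have "(\<Sum>j\<in>{-int n..int n}. s n j) = (\<Prod>i<n. 1 - z * p ^ i) * (\<Prod>i<n. 1 - p / z * p ^ i)" for n
      unfolding finite_jacobi_triple_product[OF p z] by (simp add: s_def)
    then show "(\<lambda>n. \<Sum>j\<in>{-int n..int n}. s n j) \<longlonglongrightarrow> qpoch_inf z p * qpoch_inf (p / z) p"
      by (simp only:) (intro tendsto_mult qpoch_inf_tendsto p)
    show "(\<lambda>n. s n j) \<longlonglongrightarrow> theta_term z p j / qpoch_inf p p" for j
    proof -
      have "(\<lambda>n. theta_term z p j *
          (qfact p (2 * n) / (qfact p (nat (int n + j)) * qfact p (nat (int n - j))))) \<longlonglongrightarrow>
          theta_term z p j * (qpoch_inf p p / (qpoch_inf p p * qpoch_inf p p))"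
      proof (intro tendsto_mult tendsto_divide tendsto_const filterlim_compose[OF qfact_tendsto[OF p(1)]])
        have *: "filterlim (\<lambda>n. nat (int n + c)) sequentially sequentially" for c
          unfolding filterlim_at_top eventually_sequentially
        proof (intro allI)
          fix Z
          show "\<exists>N. \<forall>n\<ge>N. Z \<le> nat (int n + c)"
            by (rule exI[of _ "Z + nat \<bar>c\<bar>"]) auto
        qed
        show "filterlim (\<lambda>n. nat (int n + j)) sequentially sequentially"
          by (rule *)
        show "filterlim (\<lambda>n. nat (int n - j)) sequentially sequentially"
          using *[of "- j"] by simp
        show "filterlim (\<lambda>n. 2 * n :: nat) sequentially sequentially"
          by (rule filterlim_subseq) (auto simp: strict_mono_def)
      qed (use nz in auto)
      \<comment> \<open>Once \<open>n\<close> is at least \<open>|j|\<close>, \<open>nat\<close>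
        truncates nothing and \<open>j\<close> lies in the summation range.\<close>
      moreover have "eventually (\<lambda>n. s n j = theta_term z p j *
          (qfact p (2 * n) / (qfact p (nat (int n + j)) * qfact p (nat (int n - j))))) sequentially"
        using eventually_ge_at_top[of "nat \<bar>j\<bar>"]
      proof eventually_elim
        case (elim n)
        then have "nat (j + int n) \<le> 2 * n" "2 * n - nat (j + int n) = nat (int n - j)"
          "j \<in> {-int n..int n}"
          by auto
        then show ?case
          by (simp add: s_def qbinom_def add.commute)
      qed
      ultimately show ?thesis
        using nz by (simp add: filterlim_cong)
    qed
  qed (auto simp: s_def)
  from has_sum_cmult_left[OF this, of "qpoch_inf p p"] show ?thesis
    using nz by simp
qed

section \<open>The theta identity\<close>

lemma qpoch_inf_split:
  assumes q: "norm q < 1" and m: "m > 0"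
  shows "qpoch_inf a q = (\<Prod>r<m. qpoch_inf (a * q ^ r) (q ^ m))"
proof -
  have qm: "norm (q ^ m) < 1"
    using assms by (simp add: norm_power power_less_one_iff)
  \<comment> \<open>With \<open>m * n\<close> factors, every residue class modulo \<open>m\<close>
    contributes exactly \<open>n\<close>.\<close>
  have "(\<Prod>i<m*n. 1 - a * q ^ i) = (\<Prod>r<m. \<Prod>i<n. 1 - a * q ^ r * (q ^ m) ^ i)" for n
  proof (induction n)
    case (Suc n)
    have "{..<m * Suc n} = {..<m*n} \<union> {m*n..<m*n+m}"
      by auto
    then have "(\<Prod>i<m * Suc n. 1 - a * q ^ i) = (\<Prod>i<m*n. 1 - a * q ^ i) * (\<Prod>r<m. 1 - a * q ^ (r + m*n))"
      using prod.shift_bounds_nat_ivl[of "\<lambda>i. 1 - a * q ^ i" 0 "m*n" m]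
      by (simp add: prod.union_disjoint ivl_disj_int add.commute atLeast0LessThan)
    then show ?case
      by (simp add: Suc prod.distrib power_add power_mult mult.assoc)
  qed simp
  moreover have "(\<lambda>n. \<Prod>i<m*n. 1 - a * q ^ i) \<longlonglongrightarrow> qpoch_inf a q"
    using m by (intro filterlim_compose[OF qpoch_inf_tendsto[OF q]] filterlim_subseq)
      (auto simp: strict_mono_def)
  moreover have "(\<lambda>n. \<Prod>r<m. \<Prod>i<n. 1 - a * q ^ r * (q ^ m) ^ i) \<longlonglongrightarrow>
      (\<Prod>r<m. qpoch_inf (a * q ^ r) (q ^ m))"
    by (intro tendsto_prod qpoch_inf_tendsto qm)
  ultimately show ?thesis
    using LIMSEQ_unique by simp
qed

lemma qpoch_inf_split_3:
  assumes "norm q < 1"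
  shows "qpoch_inf q q = qpoch_inf q (q ^ 3) * qpoch_inf (q ^ 2) (q ^ 3) * qpoch_inf (q ^ 3) (q ^ 3)"
proof -
  have "{..<3} = {0, 1, 2 :: nat}"
    by auto
  then show ?thesis
    using qpoch_inf_split[OF assms, of 3 q]
    by (simp add: mult.assoc power2_eq_square power3_eq_cube)
qed

lemma qpoch_inf_split_5:
  assumes "norm q < 1"
  shows "qpoch_inf q q = qpochs_inf [q, q ^ 4] (q ^ 5) * qpochs_inf [q ^ 2, q ^ 3, q ^ 5] (q ^ 5)"
proof -
  have "{..<5} = {0, 1, 2, 3, 4 :: nat}"
    by auto
  moreover have "q * q = q ^ 2" "q * q ^ 2 = q ^ 3" "q * q ^ 3 = q ^ 4" "q * q ^ 4 = q ^ 5"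
    by (simp_all add: eval_nat_numeral)
  ultimately show ?thesis
    using qpoch_inf_split[OF assms, of 5 q] by (simp add: qpochs_inf_def mult_ac)
qed

section \<open>The three theta series coming from products\<close>

lemma theta_term_power:
  assumes "x \<noteq> 0"
  shows "theta_term ((x ^ 840) ^ a) ((x ^ 840) ^ b) k =
    (-1) powi k * x powi (840 * int a * k + 420 * int b * (k * (k - 1)))"
proof -
  have pw: "((x ^ 840) ^ c) powi i = x powi (840 * int c * i)" for c i
  proof -
    have "(x ^ 840) ^ c = x powi int (840 * c)"
      by (simp only: power_int_of_nat power_mult)
    then show ?thesis
      by (simp add: power_int_mult)
  qed
  \<comment> \<open>Removing the \<open>div 2\<close> makes the exponent a polynomial in
    \<open>k\<close>, so that squares can be completed by ring algebra.\<close>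
  have "840 * int b * (k * (k - 1) div 2) = 420 * int b * (2 * (k * (k - 1) div 2))"
    by simp
  also have "2 * (k * (k - 1) div 2) = k * (k - 1)"
    using even_int_mult_pred[of k] by (rule dvd_mult_div_cancel)
  finally have e: "840 * int b * (k * (k - 1) div 2) = 420 * int b * (k * (k - 1))" .
  show ?thesis
    using assms unfolding theta_term_def pw e by (simp add: power_int_add)
qed

context
  fixes x :: complex
  assumes x0: "x \<noteq> 0" and x1: "norm x < 1"
begin

lemma norm_power_less_1: "n > 0 \<Longrightarrow> norm (x ^ n) < 1"
  using x1 by (simp add: norm_power power_less_one_iff)

text \<open>With \<open>q = x ^ 840\<close>, the triple product for base \<open>q ^ 5\<close> and
  \<open>z = q ^ 3\<close>; the factor \<open>x ^ 21\<close> completes the square in the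
  exponent.\<close>

lemma has_sum_theta5:
  "((\<lambda>k. (-1) powi k * x powi (21 * (10 * k + 1)\<^sup>2)) has_sum
    x ^ 21 * qpochs_inf [(x ^ 840) ^ 2, (x ^ 840) ^ 3, (x ^ 840) ^ 5] ((x ^ 840) ^ 5)) UNIV"
proof -
  let ?q = "x ^ 840"
  have "(theta_term (?q ^ 3) (?q ^ 5) has_sum
      qpoch_inf (?q ^ 3) (?q ^ 5) * qpoch_inf (?q ^ 5 / ?q ^ 3) (?q ^ 5) * qpoch_inf (?q ^ 5) (?q ^ 5)) UNIV"
    using norm_power_less_1 x0 by (intro jacobi_triple_product) (simp_all flip: power_mult)
  also have "?q ^ 5 / ?q ^ 3 = ?q ^ 2"
    using x0 by (simp flip: power_diff)
  finally have "((\<lambda>k. x ^ 21 * theta_term (?q ^ 3) (?q ^ 5) k) has_sum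
      x ^ 21 * qpochs_inf [?q ^ 2, ?q ^ 3, ?q ^ 5] (?q ^ 5)) UNIV"
    unfolding qpochs_inf_def by (intro has_sum_cmult_right) (simp add: mult_ac)
  moreover have "x ^ 21 * theta_term (?q ^ 3) (?q ^ 5) k = (-1) powi k * x powi (21 * (10 * k + 1)\<^sup>2)" for k
  proof -
    have "21 * (10 * k + 1)\<^sup>2 = 21 + (840 * int 3 * k + 420 * int 5 * (k * (k - 1)))"
      by (simp add: power2_eq_square algebra_simps)
    then show ?thesis
      unfolding theta_term_power[OF x0] using x0 by (simp add: power_int_add)
  qed
  ultimately show ?thesis
    by simp
qed

text \<open>The same for base \<open>q ^ 7\<close> and \<open>z = q ^ 4\<close>.\<close>

lemma has_sum_theta7:
  "((\<lambda>k. (-1) powi k * x powi (15 * (14 * k + 1)\<^sup>2)) has_sum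
    x ^ 15 * qpochs_inf [(x ^ 840) ^ 3, (x ^ 840) ^ 4, (x ^ 840) ^ 7] ((x ^ 840) ^ 7)) UNIV"
proof -
  let ?q = "x ^ 840"
  have "(theta_term (?q ^ 4) (?q ^ 7) has_sum
      qpoch_inf (?q ^ 4) (?q ^ 7) * qpoch_inf (?q ^ 7 / ?q ^ 4) (?q ^ 7) * qpoch_inf (?q ^ 7) (?q ^ 7)) UNIV"
    using norm_power_less_1 x0 by (intro jacobi_triple_product) (simp_all flip: power_mult)
  also have "?q ^ 7 / ?q ^ 4 = ?q ^ 3"
    using x0 by (simp flip: power_diff)
  finally have "((\<lambda>k. x ^ 15 * theta_term (?q ^ 4) (?q ^ 7) k) has_sum
      x ^ 15 * qpochs_inf [?q ^ 3, ?q ^ 4, ?q ^ 7] (?q ^ 7)) UNIV"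
    unfolding qpochs_inf_def by (intro has_sum_cmult_right) (simp add: mult_ac)
  moreover have "x ^ 15 * theta_term (?q ^ 4) (?q ^ 7) k = (-1) powi k * x powi (15 * (14 * k + 1)\<^sup>2)" for k
  proof -
    have "15 * (14 * k + 1)\<^sup>2 = 15 + (840 * int 4 * k + 420 * int 7 * (k * (k - 1)))"
      by (simp add: power2_eq_square algebra_simps)
    then show ?thesis
      unfolding theta_term_power[OF x0] using x0 by (simp add: power_int_add)
  qed
  ultimately show ?thesis
    by simp
qed

text \<open>Euler's pentagonal number theorem: for base \<open>q ^ 3\<close> and
  \<open>z = q ^ 2\<close> the three products recombine to \<open>qpoch_inf q q\<close>.\<close>

lemma has_sum_euler_pentagonal:
  "((\<lambda>k. (-1) powi k * x powi (35 * (6 * k + 1)\<^sup>2)) has_sum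
    x ^ 35 * qpoch_inf (x ^ 840) (x ^ 840)) UNIV"
proof -
  let ?q = "x ^ 840"
  have "(theta_term (?q ^ 2) (?q ^ 3) has_sum
      qpoch_inf (?q ^ 2) (?q ^ 3) * qpoch_inf (?q ^ 3 / ?q ^ 2) (?q ^ 3) * qpoch_inf (?q ^ 3) (?q ^ 3)) UNIV"
    using norm_power_less_1 x0 by (intro jacobi_triple_product) (simp_all flip: power_mult)
  also have "?q ^ 3 / ?q ^ 2 = ?q"
    using x0 by (simp flip: power_mult power_diff)
  also have "qpoch_inf (?q ^ 2) (?q ^ 3) * qpoch_inf ?q (?q ^ 3) * qpoch_inf (?q ^ 3) (?q ^ 3) =
      qpoch_inf ?q ?q"
    using qpoch_inf_split_3[of ?q] norm_power_less_1[of 840] by (simp only: mult_ac)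
  finally have "((\<lambda>k. x ^ 35 * theta_term (?q ^ 2) (?q ^ 3) k) has_sum x ^ 35 * qpoch_inf ?q ?q) UNIV"
    by (rule has_sum_cmult_right)
  moreover have "x ^ 35 * theta_term (?q ^ 2) (?q ^ 3) k = (-1) powi k * x powi (35 * (6 * k + 1)\<^sup>2)" for k
  proof -
    have "35 * (6 * k + 1)\<^sup>2 = 35 + (840 * int 2 * k + 420 * int 3 * (k * (k - 1)))"
      by (simp add: power2_eq_square algebra_simps)
    then show ?thesis
      unfolding theta_term_power[OF x0] using x0 by (simp add: power_int_add)
  qed
  ultimately show ?thesis
    by simp
qed

end

section \<open>The sign attached to D\<close>

lemma minus_one_powi: "(-1 :: complex) powi k = (if even k then 1 else -1)"
  by (simp add: power_int_minus_left)

text \<open>\<open>(d + 105) div 210\<close> is the integer nearest to \<open>d / 210\<close>, and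
  its parity gives the sign; ties occur only at multiples of 3, where the value is 0.\<close>

definition square_sign :: "int \<Rightarrow> complex" where
  "square_sign d = (if 3 dvd d then 0 else (-1) powi ((d + 105) div 210))"

lemma dvd_3_add_210_mult: "3 dvd 210 * k + r \<longleftrightarrow> 3 dvd r" for k r :: int
proof -
  have "210 * k + r = r + 3 * (70 * k)"
    by simp
  then show ?thesis
    by (metis dvd_add_left_iff dvd_triv_left)
qed

lemma square_sign_add_210_mult: "square_sign (210 * k + r) = (-1) powi k * square_sign r"
proof -
  have "(210 * k + r + 105) div 210 = k + (r + 105) div 210"
    using div_mult_self1[of 210 "r + 105" k] by (simp add: algebra_simps)
  then show ?thesis
    by (auto simp: square_sign_def dvd_3_add_210_mult minus_one_powi)
qed

lemma square_sign_periodic: "square_sign (d + 420 * m) = square_sign d"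
  using square_sign_add_210_mult[of "2 * m" d] by (simp add: minus_one_powi add.commute)

context
  fixes x :: complex
  assumes x0: "x \<noteq> 0" and x1: "norm x < 1"
begin

text \<open>This is the theta series with \<open>z = -x\<close> and base \<open>x ^ 2\<close>. The
  context closes after it so that the lemma can be applied at \<open>x ^ 35\<close>.\<close>

lemma summable_powi_square: "(\<lambda>c. x powi (c\<^sup>2)) summable_on A"
proof -
  have "(\<lambda>j. norm (theta_term (- x) (x ^ 2) j)) summable_on UNIV"
    using norm_power_less_1[OF x0 x1] x0 by (intro abs_summable_theta_term) simp_all
  moreover have "theta_term (- x) (x ^ 2) j = x powi (j\<^sup>2)" for j
  proof -
    have "(x ^ 2) powi i = x powi (2 * i)" for i
      by (simp add: power_int_mult)
    then have "(x ^ 2) powi (j * (j - 1) div 2) = x powi (2 * (j * (j - 1) div 2))" .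
    also have "2 * (j * (j - 1) div 2) = j\<^sup>2 - j"
      by (simp add: power2_eq_square algebra_simps)
    finally show ?thesis
      using x0 by (simp add: theta_term_def power_int_diff power_int_minus_left)
  qed
  ultimately have "(\<lambda>j. norm (x powi (j\<^sup>2))) summable_on UNIV"
    by simp
  then show ?thesis
    by (rule summable_on_subset_banach[OF abs_summable_summable]) simp
qed

end

section \<open>Theta series of 35C^2 and 35C^2 + D^2 on residue classes\<close>

context
  fixes x :: complex
  assumes x0: "x \<noteq> 0" and x1: "norm x < 1"
begin

definition ptheta :: "int \<Rightarrow> complex" where
  "ptheta a = (\<Sum>\<^sub>\<infinity>n. x powi (35 * (12 * n + a)\<^sup>2))"

text \<open>The pairs \<open>C = 12 * n + a - 2 * j\<close>, \<open>D = 70 * j + b\<close> form a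
  coset of a plane lattice: raising D by 70 moves the class of C modulo 12 by -2. Such cosets arise
  from \<open>(A, B)\<close> by the two substitutions.\<close>

definition pair_theta :: "int \<Rightarrow> int \<Rightarrow> complex" where
  "pair_theta a b = (\<Sum>\<^sub>\<infinity>(j, n). x powi (35 * (12 * n + a - 2 * j)\<^sup>2 + (70 * j + b)\<^sup>2))"

lemma summable_powi_35_square: "(\<lambda>c. x powi (35 * c\<^sup>2)) summable_on A"
  using summable_powi_square[of "x ^ 35" A] x0 norm_power_less_1[OF x0 x1, of 35]
  by (simp add: power_int_mult)

lemma has_sum_ptheta: "((\<lambda>n. x powi (35 * (12 * n + a)\<^sup>2)) has_sum ptheta a) UNIV"
proof -
  have "(\<lambda>c. x powi (35 * c\<^sup>2)) summable_on range (\<lambda>n. 12 * n + a)"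
    by (rule summable_powi_35_square)
  then show ?thesis
    unfolding ptheta_def by (subst (asm) summable_on_reindex) (auto simp: inj_on_def o_def)
qed

lemma ptheta_periodic: "ptheta (a + 12 * m) = ptheta a"
proof -
  have "((\<lambda>n. x powi (35 * (12 * n + a)\<^sup>2)) has_sum ptheta (a + 12 * m)) UNIV"
    using has_sum_ptheta[of "a + 12 * m"]
    by (subst has_sum_reindex_bij_witness[of UNIV "\<lambda>n. n + m" "\<lambda>n. n - m"])
      (auto simp: algebra_simps)
  then show ?thesis
    using has_sum_ptheta has_sum_unique by blast
qed

lemma ptheta_minus: "ptheta (- a) = ptheta a"
proof -
  have "35 * (12 * n + a)\<^sup>2 = 35 * (12 * (- n) + - a)\<^sup>2" for n :: int
    by (simp add: power2_eq_square algebra_simps)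
  then have "((\<lambda>n. x powi (35 * (12 * n + a)\<^sup>2)) has_sum ptheta (- a)) UNIV"
    using has_sum_ptheta[of "- a"]
    by (subst has_sum_reindex_bij_witness[of UNIV uminus uminus]) auto
  then show ?thesis
    using has_sum_ptheta has_sum_unique by blast
qed

text \<open>The map from \<open>(j, n)\<close> to \<open>(C, D)\<close> is injective, so summability
  is inherited from the product of two theta series in one variable.\<close>

lemma has_sum_pair_theta:
  "((\<lambda>(j, n). x powi (35 * (12 * n + a - 2 * j)\<^sup>2 + (70 * j + b)\<^sup>2)) has_sum pair_theta a b) UNIV"
proof -
  have "((\<lambda>(c, d). x powi (35 * c\<^sup>2) * x powi (d\<^sup>2)) has_sum
      infsum (\<lambda>c. x powi (35 * c\<^sup>2)) UNIV * infsum (\<lambda>d. x powi (d\<^sup>2)) UNIV) (UNIV \<times> UNIV)"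
    by (intro has_sum_mult_complex has_sum_infsum summable_powi_35_square summable_powi_square x0 x1)
  then have "(\<lambda>(c, d). x powi (35 * c\<^sup>2) * x powi (d\<^sup>2)) summable_on UNIV"
    by (auto dest: has_sum_imp_summable)
  then have "(\<lambda>(c, d). x powi (35 * c\<^sup>2) * x powi (d\<^sup>2)) summable_on
      range (\<lambda>(j, n). (12 * n + a - 2 * j, 70 * j + b))"
    by (rule summable_on_subset_banach) simp
  then show ?thesis
    unfolding pair_theta_def using x0
    by (subst (asm) summable_on_reindex)
      (auto simp: inj_on_def o_def case_prod_unfold power_int_add intro!: has_sum_infsum)
qed

text \<open>Summing over \<open>n\<close> first leaves one full \<open>ptheta\<close> series for
  each D.\<close>

lemma has_sum_pair_theta_rows:
  "((\<lambda>j. x powi ((70 * j + b)\<^sup>2) * ptheta (a - 2 * j)) has_sum pair_theta a b) UNIV"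
proof (rule has_sum_SigmaD)
  show "((\<lambda>(j, n). x powi (35 * (12 * n + a - 2 * j)\<^sup>2 + (70 * j + b)\<^sup>2)) has_sum pair_theta a b)
      (UNIV \<times> UNIV)"
    using has_sum_pair_theta by simp
  show "((\<lambda>n. case (j, n) of (j, n) \<Rightarrow> x powi (35 * (12 * n + a - 2 * j)\<^sup>2 + (70 * j + b)\<^sup>2)) has_sum
      x powi ((70 * j + b)\<^sup>2) * ptheta (a - 2 * j)) UNIV" for j
    using has_sum_cmult_right[OF has_sum_ptheta[of "a - 2 * j"], of "x powi ((70 * j + b)\<^sup>2)"] x0
    by (simp add: power_int_add mult.commute add_diff_eq)
qed

text \<open>The reindexing sends \<open>(D + C\<surd>-35)/2\<close> to the product of its conjugate and
  \<open>(1 + \<surd>-35)/6\<close>, an element of norm 1.\<close>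

lemma pair_theta_swap: "pair_theta 7 1 = pair_theta (-1) 41"
proof -
  have "35 * (12 * j + (-1) - 2 * n)\<^sup>2 + (70 * n + 41)\<^sup>2 =
      35 * (12 * n + 7 - 2 * j)\<^sup>2 + (70 * j + 1)\<^sup>2" for j n :: int
    by (simp add: power2_eq_square algebra_simps)
  then have "((\<lambda>(j, n). x powi (35 * (12 * n + 7 - 2 * j)\<^sup>2 + (70 * j + 1)\<^sup>2)) has_sum
      pair_theta (-1) 41) (UNIV \<times> UNIV)"
    using has_sum_pair_theta[of "-1" 41] by (subst has_sum_swap) simp
  then show ?thesis
    using has_sum_pair_theta[of 7 1] has_sum_unique by fastforce
qed

section \<open>Comparison of the two sides as sums over (C, D)\<close>

lemma theta5_theta7_parity_split:
  assumes "((\<lambda>k. (-1) powi k * x powi (21 * (10 * k + 1)\<^sup>2)) has_sum s) UNIV"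
    and "((\<lambda>k. (-1) powi k * x powi (15 * (14 * k + 1)\<^sup>2)) has_sum t) UNIV"
  shows "s * t = pair_theta 1 1 - pair_theta 5 41"
proof -
  define f where "f = (\<lambda>(k, n). (-1) powi k * x powi (21 * (10 * k + 1)\<^sup>2) *
    ((-1) powi n * x powi (15 * (14 * n + 1)\<^sup>2)))"
  define E where "E = {(k, n :: int). even (k + n)}"
  have st: "(f has_sum s * t) UNIV"
    using has_sum_mult_complex[OF assms] by (simp add: f_def)
  \<comment> \<open>The substitution \<open>((A + B)/2, (7A - 5B)/2)\<close> has
    \<open>D = 35 * (k - n) + 1\<close>, which is 1 modulo 70 exactly when \<open>k + n\<close> is
    even.\<close>
  have "(f has_sum pair_theta 1 1) E"
  proof (subst has_sum_reindex_bij_witness[of E "\<lambda>(j, n). (n + j, n - j)"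
        "\<lambda>(k, n). ((k - n) div 2, (k + n) div 2)" UNIV])
    show "((\<lambda>(j, n). x powi (35 * (12 * n + 1 - 2 * j)\<^sup>2 + (70 * j + 1)\<^sup>2)) has_sum pair_theta 1 1) UNIV"
      by (rule has_sum_pair_theta)
  next
    fix p assume "p \<in> E"
    then obtain k n where p: "p = (k, n)" "even (k + n)"
      by (auto simp: E_def)
    define j m where "j = (k - n) div 2" and "m = (k + n) div 2"
    have k: "k = m + j" "n = m - j"
      using p(2) unfolding j_def m_def by presburger+
    have "35 * (12 * m + 1 - 2 * j)\<^sup>2 + (70 * j + 1)\<^sup>2 =
        21 * (10 * k + 1)\<^sup>2 + 15 * (14 * n + 1)\<^sup>2"
      by (simp add: k power2_eq_square algebra_simps)
    then have "x powi (35 * (12 * m + 1 - 2 * j)\<^sup>2 + (70 * j + 1)\<^sup>2) = f (k, n)"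
      using x0 p(2) by (auto simp: f_def power_int_add minus_one_powi)
    then show "(case (case p of (k, n) \<Rightarrow> ((k - n) div 2, (k + n) div 2)) of
        (j, n) \<Rightarrow> x powi (35 * (12 * n + 1 - 2 * j)\<^sup>2 + (70 * j + 1)\<^sup>2)) = f p"
      by (simp add: p j_def m_def)
    show "(case (case p of (k, n) \<Rightarrow> ((k - n) div 2, (k + n) div 2)) of
        (j, n) \<Rightarrow> (n + j, n - j)) = p"
      unfolding p prod.case j_def[symmetric] m_def[symmetric] by (simp flip: k)
  qed (auto simp: E_def)
  \<comment> \<open>For odd \<open>k + n\<close> the sign is -1, and
    \<open>((A - B)/2, (7A + 5B)/2)\<close> has \<open>D = 35 * (k + n) + 6\<close>, which is 41
    modulo 70.\<close>
  moreover have "(f has_sum - pair_theta 5 41) (- E)"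
  proof (subst has_sum_reindex_bij_witness[of "- E" "\<lambda>(j, n). (j + 1 + n, j - n)"
        "\<lambda>(k, n). ((k + n) div 2, (k - n) div 2)" UNIV])
    show "((\<lambda>p. - (case p of (j, n) \<Rightarrow> x powi (35 * (12 * n + 5 - 2 * j)\<^sup>2 + (70 * j + 41)\<^sup>2))) has_sum
        - pair_theta 5 41) UNIV"
      by (intro has_sum_uminusI has_sum_pair_theta)
  next
    fix p assume "p \<in> - E"
    then obtain k n where p: "p = (k, n)" "odd (k + n)"
      by (cases p) (auto simp: E_def)
    define j m where "j = (k + n) div 2" and "m = (k - n) div 2"
    have k: "k = j + 1 + m" "n = j - m"
      using p(2) unfolding j_def m_def by presburger+
    have "35 * (12 * m + 5 - 2 * j)\<^sup>2 + (70 * j + 41)\<^sup>2 =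
        21 * (10 * k + 1)\<^sup>2 + 15 * (14 * n + 1)\<^sup>2"
      by (simp add: k power2_eq_square algebra_simps)
    then have "- (x powi (35 * (12 * m + 5 - 2 * j)\<^sup>2 + (70 * j + 41)\<^sup>2)) = f (k, n)"
      using x0 p(2) by (auto simp: f_def power_int_add minus_one_powi)
    then show "- (case (case p of (k, n) \<Rightarrow> ((k + n) div 2, (k - n) div 2)) of
        (j, n) \<Rightarrow> x powi (35 * (12 * n + 5 - 2 * j)\<^sup>2 + (70 * j + 41)\<^sup>2)) = f p"
      by (simp add: p j_def m_def)
    show "(case (case p of (k, n) \<Rightarrow> ((k + n) div 2, (k - n) div 2)) of
        (j, n) \<Rightarrow> (j + 1 + n, j - n)) = p"
      unfolding p prod.case j_def[symmetric] m_def[symmetric] by (simp flip: k)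
  next
    fix p :: "int \<times> int"
    obtain j n where p: "p = (j, n)"
      by fastforce
    show "(case (case p of (j, n) \<Rightarrow> (j + 1 + n, j - n)) of
        (k, n) \<Rightarrow> ((k + n) div 2, (k - n) div 2)) = p"
      unfolding p by simp
    show "(case p of (j, n) \<Rightarrow> (j + 1 + n, j - n)) \<in> - E"
      by (auto simp: p E_def)
  qed simp_all
  ultimately have "(f has_sum pair_theta 1 1 + - pair_theta 5 41) (E \<union> - E)"
    by (rule has_sum_Un_disjoint) simp
  then show ?thesis
    using has_sum_unique[OF st] by simp
qed

text \<open>The parity of \<open>k\<close> splits \<open>6 * k + 1\<close> into the classes 1 and 7
  modulo 12, and 7 is -5 there.\<close>

lemma euler_eq_ptheta:
  assumes "((\<lambda>k. (-1) powi k * x powi (35 * (6 * k + 1)\<^sup>2)) has_sum s) UNIV"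
  shows "s = ptheta 1 - ptheta 5"
proof -
  define f where "f k = (-1) powi k * x powi (35 * (6 * k + 1)\<^sup>2)" for k
  have "(f has_sum ptheta 1) {k. even k}"
    by (subst has_sum_reindex_bij_witness[of "{k. even k}" "\<lambda>n. 2 * n" "\<lambda>k. k div 2" UNIV])
      (use has_sum_ptheta[of 1] in \<open>auto simp: f_def minus_one_powi\<close>)
  moreover have "(f has_sum - ptheta 7) {k. odd k}"
  proof (subst has_sum_reindex_bij_witness[of "{k. odd k}" "\<lambda>n. 2 * n + 1" "\<lambda>k. k div 2" UNIV])
    show "((\<lambda>n. - (x powi (35 * (12 * n + 7)\<^sup>2))) has_sum - ptheta 7) UNIV"
      by (intro has_sum_uminusI has_sum_ptheta)
    fix k :: int assume "k \<in> {k. odd k}"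
    then obtain n where "k = 2 * n + 1"
      by (auto elim: oddE)
    then show "- (x powi (35 * (12 * (k div 2) + 7)\<^sup>2)) = f k"
      by (simp add: f_def minus_one_powi add.commute)
  qed auto
  ultimately have "(f has_sum ptheta 1 + - ptheta 7) ({k. even k} \<union> {k. odd k})"
    by (rule has_sum_Un_disjoint) auto
  also have "{k. even k} \<union> {k. odd k} = (UNIV :: int set)"
    by auto
  finally have "s = ptheta 1 - ptheta 7"
    using has_sum_unique[OF assms] by (simp add: f_def[abs_def])
  also have "ptheta 7 = ptheta 5"
    using ptheta_periodic[of "-5" 1] ptheta_minus[of 5] by simp
  finally show ?thesis .
qed

text \<open>Up to sign, the odd classes modulo 12 are 1, 3 and 5. The arguments listed are the
  others that occur in the six cases of the next two lemmas.\<close>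

lemma ptheta_reduce:
  "ptheta (-1) = ptheta 1" "ptheta (-3) = ptheta 3" "ptheta (-5) = ptheta 5" "ptheta 7 = ptheta 5"
  "ptheta (-7) = ptheta 5" "ptheta (-9) = ptheta 3" "ptheta (-11) = ptheta 1"
  using ptheta_minus[of 1] ptheta_minus[of 3] ptheta_minus[of 5] ptheta_periodic[of "-5" 1]
    ptheta_periodic[of 5 "-1"] ptheta_periodic[of 3 "-1"] ptheta_periodic[of 1 "-1"]
  by simp_all

text \<open>Both sides depend only on \<open>j\<close> modulo 6. The numbers
  \<open>1 - 2 * j\<close> and \<open>70 * j + 1\<close> agree modulo 3; when 3 divides them, both
  terms on the left equal \<open>ptheta 3\<close>, which is the cancellation under C to -C.\<close>

lemma ptheta_diff_1:
  "ptheta (1 - 2 * j) - ptheta (7 - 2 * j) = square_sign (70 * j + 1) * (ptheta 1 - ptheta 5)"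
proof -
  define m r where "m = j div 6" and "r = j mod 6"
  have j: "j = 6 * m + r"
    by (simp add: m_def r_def)
  have "1 - 2 * j = (1 - 2 * r) + 12 * (- m)" "7 - 2 * j = (7 - 2 * r) + 12 * (- m)"
    "70 * j + 1 = (70 * r + 1) + 420 * m"
    by (simp_all add: j)
  then have *: "ptheta (1 - 2 * j) = ptheta (1 - 2 * r)" "ptheta (7 - 2 * j) = ptheta (7 - 2 * r)"
    "square_sign (70 * j + 1) = square_sign (70 * r + 1)"
    by (simp_all only: ptheta_periodic square_sign_periodic)
  have "r \<in> {0, 1, 2, 3, 4, 5}"
    unfolding r_def using pos_mod_bound[of 6 j] pos_mod_sign[of 6 j] by auto
  then show ?thesis
    unfolding * by (auto simp: square_sign_def ptheta_reduce minus_one_powi)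
qed

lemma ptheta_diff_41:
  "ptheta (-1 - 2 * j) - ptheta (5 - 2 * j) = square_sign (70 * j + 41) * (ptheta 1 - ptheta 5)"
proof -
  define m r where "m = j div 6" and "r = j mod 6"
  have j: "j = 6 * m + r"
    by (simp add: m_def r_def)
  have "-1 - 2 * j = (-1 - 2 * r) + 12 * (- m)" "5 - 2 * j = (5 - 2 * r) + 12 * (- m)"
    "70 * j + 41 = (70 * r + 41) + 420 * m"
    by (simp_all add: j)
  then have *: "ptheta (-1 - 2 * j) = ptheta (-1 - 2 * r)" "ptheta (5 - 2 * j) = ptheta (5 - 2 * r)"
    "square_sign (70 * j + 41) = square_sign (70 * r + 41)"
    by (simp_all only: ptheta_periodic square_sign_periodic)
  have "r \<in> {0, 1, 2, 3, 4, 5}"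
    unfolding r_def using pos_mod_bound[of 6 j] pos_mod_sign[of 6 j] by auto
  then show ?thesis
    unfolding * by (auto simp: square_sign_def ptheta_reduce minus_one_powi)
qed

text \<open>\<open>u * v = pair_theta 1 1 - pair_theta 7 1\<close> and
  \<open>u * w = pair_theta (-1) 41 - pair_theta 5 41\<close>. By \<open>pair_theta_swap\<close> the
  inner two cancel, and the parity split of \<open>s * t\<close> is left.\<close>

lemma theta5_theta7_eq:
  assumes "((\<lambda>k. (-1) powi k * x powi (21 * (10 * k + 1)\<^sup>2)) has_sum s) UNIV"
    and "((\<lambda>k. (-1) powi k * x powi (15 * (14 * k + 1)\<^sup>2)) has_sum t) UNIV"
    and "((\<lambda>k. (-1) powi k * x powi (35 * (6 * k + 1)\<^sup>2)) has_sum u) UNIV"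
    and "((\<lambda>j. square_sign (70 * j + 1) * x powi ((70 * j + 1)\<^sup>2)) has_sum v) UNIV"
    and "((\<lambda>j. square_sign (70 * j + 41) * x powi ((70 * j + 41)\<^sup>2)) has_sum w) UNIV"
  shows "s * t = u * (v + w)"
proof -
  have u: "u = ptheta 1 - ptheta 5"
    by (rule euler_eq_ptheta) fact
  have coeff1: "u * (square_sign (70 * j + 1) * x powi ((70 * j + 1)\<^sup>2)) =
      x powi ((70 * j + 1)\<^sup>2) * ptheta (1 - 2 * j) + - (x powi ((70 * j + 1)\<^sup>2) * ptheta (7 - 2 * j))"
    for j
  proof -
    have "x powi ((70 * j + 1)\<^sup>2) * ptheta (1 - 2 * j) + - (x powi ((70 * j + 1)\<^sup>2) * ptheta (7 - 2 * j)) =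
        x powi ((70 * j + 1)\<^sup>2) * (ptheta (1 - 2 * j) - ptheta (7 - 2 * j))"
      by (simp add: right_diff_distrib)
    then show ?thesis
      unfolding ptheta_diff_1 u by (simp add: mult.commute mult.left_commute)
  qed
  have "((\<lambda>j. u * (square_sign (70 * j + 1) * x powi ((70 * j + 1)\<^sup>2))) has_sum
      pair_theta 1 1 + - pair_theta 7 1) UNIV"
    unfolding coeff1 by (intro has_sum_add has_sum_uminusI has_sum_pair_theta_rows)
  then have v: "u * v = pair_theta 1 1 - pair_theta 7 1"
    using has_sum_cmult_right[OF assms(4), of u] has_sum_unique by fastforce
  have coeff41: "u * (square_sign (70 * j + 41) * x powi ((70 * j + 41)\<^sup>2)) =
      x powi ((70 * j + 41)\<^sup>2) * ptheta (-1 - 2 * j) + - (x powi ((70 * j + 41)\<^sup>2) * ptheta (5 - 2 * j))"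
    for j
  proof -
    have "x powi ((70 * j + 41)\<^sup>2) * ptheta (-1 - 2 * j) + - (x powi ((70 * j + 41)\<^sup>2) * ptheta (5 - 2 * j)) =
        x powi ((70 * j + 41)\<^sup>2) * (ptheta (-1 - 2 * j) - ptheta (5 - 2 * j))"
      by (simp add: right_diff_distrib)
    then show ?thesis
      unfolding ptheta_diff_41 u by (simp add: mult.commute mult.left_commute)
  qed
  have "((\<lambda>j. u * (square_sign (70 * j + 41) * x powi ((70 * j + 41)\<^sup>2))) has_sum
      pair_theta (-1) 41 + - pair_theta 5 41) UNIV"
    unfolding coeff41 by (intro has_sum_add has_sum_uminusI has_sum_pair_theta_rows)
  then have "u * w = pair_theta (-1) 41 - pair_theta 5 41"
    using has_sum_cmult_right[OF assms(5), of u] has_sum_unique by fastforce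
  then show ?thesis
    using v theta5_theta7_parity_split[OF assms(1,2)] pair_theta_swap by (simp add: distrib_left)
qed

end

section \<open>The square roots of 1 modulo 840\<close>

text \<open>Reduces identifying \<open>square_index_seq\<close> to giving a strictly increasing
  function with range \<open>square_index_set\<close>.\<close>

lemma enumerate_eqI:
  fixes g :: "nat \<Rightarrow> nat"
  assumes "strict_mono g"
  shows "enumerate (range g) = g"
proof
  have inf: "infinite (range g)"
    using assms by (simp add: range_inj_infinite strict_mono_imp_inj_on)
  show "enumerate (range g) n = g n" for n
  proof (induction n)
    case 0
    show ?case
      unfolding enumerate_0
      by (rule Least_equality) (use assms in \<open>auto simp: strict_mono_less_eq\<close>)
  next
    case (Suc n)
    show ?case
      unfolding enumerate_Suc''[OF inf] Suc
      by (rule Least_equality) (use assms in \<open>auto simp: strict_mono_less strict_mono_less_eq\<close>)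
  qed
qed

text \<open>The square roots of 1 modulo 210. A root modulo 210 is odd, so its square is 1 modulo 8
  and hence modulo 840; the roots modulo 840 therefore have period 210.\<close>

definition square_root_residues :: "nat list" where
  "square_root_residues = [1, 29, 41, 71, 139, 169, 181, 209]"

lemma length_square_root_residues [simp]: "length square_root_residues = 8"
  by (simp add: square_root_residues_def)

definition square_root :: "nat \<Rightarrow> nat" where
  "square_root n = 210 * (n div 8) + square_root_residues ! (n mod 8)"

lemma nat_cases_mod_8:
  obtains k i :: nat where "n = 8 * k + i" "i \<in> {0, 1, 2, 3, 4, 5, 6, 7}"
proof
  show "n = 8 * (n div 8) + n mod 8"
    by simp
  show "n mod 8 \<in> {0, 1, 2, 3, 4, 5, 6, 7}"
    using mod_less_divisor[of 8 n] by auto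
qed

lemma square_root_add: "i < 8 \<Longrightarrow> square_root (8 * k + i) = 210 * k + square_root_residues ! i"
  by (simp add: square_root_def)

lemma strict_mono_square_root: "strict_mono square_root"
proof (rule strict_monoI_Suc)
  fix n :: nat
  obtain k i where n: "n = 8 * k + i" "i \<in> {0, 1, 2, 3, 4, 5, 6, 7}"
    by (rule nat_cases_mod_8)
  show "square_root n < square_root (Suc n)"
  proof (cases "i = 7")
    case True
    then have "Suc n = 8 * Suc k + 0"
      by (simp add: n)
    then show ?thesis
      unfolding \<open>Suc n = _\<close> using True
      by (simp only: n square_root_add) (simp add: square_root_residues_def)
  next
    case False
    then have i: "i < 8" "Suc i < 8" "square_root_residues ! i < square_root_residues ! Suc i"
      using n by (auto simp: square_root_residues_def)
    show ?thesis
      using square_root_add[of i k] square_root_add[of "Suc i" k] i by (simp add: n)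
  qed
qed

lemma square_mod_210:
  fixes r :: nat
  assumes "r < 210" "r * r mod 210 = 1"
  shows "r \<in> set square_root_residues"
proof (cases "r \<ge> 2")
  case True
  have "list_all (\<lambda>r. r * r mod 210 = 1 \<longrightarrow> r \<in> set square_root_residues) [2..<210]"
    by (simp add: square_root_residues_def)
  moreover have "r \<in> set [2..<210]"
    using True assms by (simp only: set_upt) simp
  ultimately show ?thesis
    using assms(2) unfolding list_all_iff by blast
next
  case False
  then have "r = 0 \<or> r = 1"
    by auto
  then show ?thesis
    using assms by (auto simp: square_root_residues_def)
qed

lemma range_square_root: "range square_root = {y. y\<^sup>2 mod 840 = 1}"
proof (intro equalityI subsetI)
  fix y assume "y \<in> range square_root"
  then obtain n where n: "y = square_root n"
    by auto
  define k r where "k = n div 8" and "r = square_root_residues ! (n mod 8)"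
  have r: "y = 210 * k + r"
    by (simp add: n square_root_def k_def r_def)
  have "r \<in> set square_root_residues"
    unfolding r_def by (rule nth_mem) simp
  then have "odd r" "r * r mod 840 = 1"
    by (auto simp: square_root_residues_def)
  \<comment> \<open>This turns the factor 420 in the expansion of \<open>y\<^sup>2\<close> into
    840.\<close>
  have "even (k * (105 * k + r))"
    using \<open>odd r\<close> by auto
  then obtain l where l: "k * (105 * k + r) = 2 * l"
    by (elim evenE)
  have "y\<^sup>2 = 420 * (k * (105 * k + r)) + r * r"
    by (simp add: r power2_eq_square algebra_simps)
  also have "\<dots> = r * r + 840 * l"
    by (simp add: l)
  finally show "y \<in> {y. y\<^sup>2 mod 840 = 1}"
    using \<open>r * r mod 840 = 1\<close> by simp
next
  fix y :: nat assume y: "y \<in> {y. y\<^sup>2 mod 840 = 1}"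
  define r where "r = y mod 210"
  have "r * r mod 210 = y\<^sup>2 mod 210"
    by (simp add: r_def power2_eq_square mod_mult_eq)
  also have "\<dots> = y\<^sup>2 mod 840 mod 210"
    by (simp add: mod_mod_cancel)
  finally have "r \<in> set square_root_residues"
    using y by (intro square_mod_210) (auto simp: r_def)
  then obtain i where i: "i < 8" "square_root_residues ! i = r"
    by (auto simp: in_set_conv_nth)
  have "square_root (8 * (y div 210) + i) = y"
    by (simp add: square_root_add i r_def)
  then show "y \<in> range square_root"
    by (metis rangeI)
qed

lemma square_root_square: "(square_root n)\<^sup>2 = 840 * square_index_seq n + 1"
proof -
  define g where "g n = (square_root n)\<^sup>2 div 840" for n
  have g: "(square_root n)\<^sup>2 = 840 * g n + 1" for n
  proof -
    have "(square_root n)\<^sup>2 mod 840 = 1"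
      using range_square_root by auto
    then show ?thesis
      unfolding g_def by (metis mult_div_mod_eq)
  qed
  have "range g = square_index_set"
  proof (intro equalityI subsetI)
    fix m assume "m \<in> range g"
    then obtain n where "m = g n"
      by auto
    then have "840 * m + 1 = (square_root n)\<^sup>2"
      by (simp add: g)
    then show "m \<in> square_index_set"
      unfolding square_index_set_def by (auto intro: is_nth_powerI)
  next
    fix m assume "m \<in> square_index_set"
    then obtain y where y: "840 * m + 1 = y\<^sup>2"
      by (auto simp: square_index_set_def is_nth_power_def)
    then have "y\<^sup>2 mod 840 = 1"
      by (metis mod_less mod_mult_self4 one_less_numeral_iff semiring_norm(76))
    then obtain n where "y = square_root n"
      using range_square_root by blast
    then have "m = g n"
      using y g[of n] by simp
    then show "m \<in> range g"
      by simp
  qed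
  moreover have "strict_mono g"
  proof (rule strict_monoI)
    fix a b :: nat assume "a < b"
    then have "square_root a < square_root b"
      using strict_mono_square_root by (simp add: strict_mono_less)
    then have "(square_root a)\<^sup>2 < (square_root b)\<^sup>2"
      by (intro power_strict_mono) auto
    then show "g a < g b"
      by (simp add: g)
  qed
  ultimately have "square_index_seq = g"
    using enumerate_eqI[of g] unfolding square_index_seq_def by simp
  then show ?thesis
    using g by simp
qed

text \<open>Modulo 70 the roots are 1, 41 and their negatives 69, 29. The sign moves each root into
  class 1 or 41, the classes of D in the theta identity.\<close>

definition signed_square_root :: "nat \<Rightarrow> int" where
  "signed_square_root n =
    (if n mod 8 \<in> {1, 4, 5, 7} then - int (square_root n) else int (square_root n))"

lemma signed_square_root_add:
  "signed_square_root (8 * k) = 210 * int k + 1"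
  "signed_square_root (8 * k + 1) = - (210 * int k + 29)"
  "signed_square_root (8 * k + 2) = 210 * int k + 41"
  "signed_square_root (8 * k + 3) = 210 * int k + 71"
  "signed_square_root (8 * k + 4) = - (210 * int k + 139)"
  "signed_square_root (8 * k + 5) = - (210 * int k + 169)"
  "signed_square_root (8 * k + 6) = 210 * int k + 181"
  "signed_square_root (8 * k + 7) = - (210 * int k + 209)"
proof -
  have *: "signed_square_root (8 * k + i) = (if i \<in> {1, 4, 5, 7}
      then - (210 * int k + int (square_root_residues ! i))
      else 210 * int k + int (square_root_residues ! i))" if "i < 8" for i
    using that by (simp add: signed_square_root_def square_root_add)
  show "signed_square_root (8 * k) = 210 * int k + 1"
    "signed_square_root (8 * k + 1) = - (210 * int k + 29)"
    "signed_square_root (8 * k + 2) = 210 * int k + 41"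
    "signed_square_root (8 * k + 3) = 210 * int k + 71"
    "signed_square_root (8 * k + 4) = - (210 * int k + 139)"
    "signed_square_root (8 * k + 5) = - (210 * int k + 169)"
    "signed_square_root (8 * k + 6) = 210 * int k + 181"
    "signed_square_root (8 * k + 7) = - (210 * int k + 209)"
    using *[of 0] *[of 1] *[of 2] *[of 3] *[of 4] *[of 5] *[of 6] *[of 7]
    by (simp_all add: square_root_residues_def)
qed

text \<open>The multiple of 210 nearest to \<open>square_root (8 * k + i)\<close> is
  \<open>210 * k\<close> for \<open>i < 4\<close> and \<open>210 * (k + 1)\<close> for larger
  \<open>i\<close>, whence \<open>(n + 4) div 8\<close>; negation keeps the parity.\<close>

lemma signed_square_root_residue:
  obtains k r where "signed_square_root n = 210 * k + r"
    "r \<in> {1, -29, 41, 71, -139, -169, 181, -209}" "square_sign (210 * k + r) = (-1) ^ ((n + 4) div 8)"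
proof -
  obtain k i where n: "n = 8 * k + i" "i \<in> {0, 1, 2, 3, 4, 5, 6, 7}"
    by (rule nat_cases_mod_8)
  \<comment> \<open>A minus sign goes into both parts, as in
    \<open>-(210 * k + 29) = 210 * (-k) + (-29)\<close>.\<close>
  define l r where "l = (if i \<in> {1, 4, 5, 7} then - int k else int k)"
    and "r = [1, -29, 41, 71, -139, -169, 181, -209 :: int] ! i"
  have "signed_square_root n = 210 * l + r" "r \<in> {1, -29, 41, 71, -139, -169, 181, -209}"
    using n signed_square_root_add[of k] by (auto simp: l_def r_def simp flip: One_nat_def)
  moreover have "square_sign (210 * l + r) = (-1) ^ ((n + 4) div 8)"
    unfolding square_sign_add_210_mult using n
    by (auto simp: l_def r_def square_sign_def minus_one_powi minus_one_power_iff simp flip: One_nat_def)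
  ultimately show ?thesis
    by (rule that)
qed

lemma square_sign_signed_square_root:
  "square_sign (signed_square_root n) = (-1) ^ ((n + 4) div 8)"
  by (metis signed_square_root_residue)

lemma bij_betw_signed_square_root:
  "bij_betw signed_square_root UNIV {d. (d mod 70 = 1 \<or> d mod 70 = 41) \<and> \<not> 3 dvd d}"
proof (intro bij_betw_imageI equalityI subsetI)
  show "inj signed_square_root"
  proof (rule injI)
    fix a b assume "signed_square_root a = signed_square_root b"
    then have "square_root a = square_root b"
      by (auto simp: signed_square_root_def split: if_splits)
    then show "a = b"
      using strict_mono_square_root by (simp add: strict_mono_eq)
  qed
next
  fix d assume "d \<in> range signed_square_root"
  then obtain n where "d = signed_square_root n"
    by auto
  then obtain k r where "d = 210 * k + r" "r \<in> {1, -29, 41, 71, -139, -169, 181, -209}"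
    using signed_square_root_residue[of n] by metis
  moreover have "(210 * k + r) mod 70 = r mod 70"
    using mod_mult_self1[of r "3 * k" 70] by (simp add: add.commute)
  ultimately show "d \<in> {d. (d mod 70 = 1 \<or> d mod 70 = 41) \<and> \<not> 3 dvd d}"
    by (auto simp: dvd_3_add_210_mult)
next
  fix d :: int assume asm: "d \<in> {d. (d mod 70 = 1 \<or> d mod 70 = 41) \<and> \<not> 3 dvd d}"
  define k t where "k = d div 70 div 3" and "t = d div 70 mod 3"
  have "d = 70 * (3 * k + t) + d mod 70"
    by (simp add: k_def t_def)
  then have "d = 210 * k + (70 * t + 1) \<or> d = 210 * k + (70 * t + 41)"
    using asm by auto
  moreover have "t \<in> {0, 1, 2}"
    unfolding t_def using pos_mod_bound[of 3 "d div 70"] pos_mod_sign[of 3 "d div 70"] by auto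
  \<comment> \<open>Of the residues 1, 71, 141 and 41, 111, 181 modulo 210, the multiples of 3 drop
    out.\<close>
  ultimately have d: "d = 210 * k + 1 \<or> d = 210 * k + 41 \<or> d = 210 * k + 71 \<or> d = 210 * k + 181"
    using asm by (auto simp: dvd_3_add_210_mult)
  show "d \<in> range signed_square_root"
  proof (cases "k \<ge> 0")
    case True
    then obtain m where "k = int m"
      using nonneg_int_cases by blast
    then show ?thesis
      using d signed_square_root_add[of m] by (metis rangeI)
  next
    case False
    \<comment> \<open>Negative \<open>k = - m - 1\<close> yields the negated roots, for example
      \<open>210 * k + 1 = -(210 * m + 209)\<close>.\<close>
    then have "k = - int (nat (- k - 1)) - 1"
      by simp
    then obtain m where "k = - int m - 1" ..
    then have "d = - (210 * int m + 209) \<or> d = - (210 * int m + 169) \<or>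
        d = - (210 * int m + 139) \<or> d = - (210 * int m + 29)"
      using d by auto
    then show ?thesis
      using signed_square_root_add[of m] by (metis rangeI)
  qed
qed

lemma has_sum_signed_squares:
  assumes "((\<lambda>j. square_sign (70 * j + 1) * x powi ((70 * j + 1)\<^sup>2)) has_sum v) UNIV"
    and "((\<lambda>j. square_sign (70 * j + 41) * x powi ((70 * j + 41)\<^sup>2)) has_sum w) UNIV"
  shows "((\<lambda>n. (-1) ^ ((n + 4) div 8) * x ^ (840 * square_index_seq n + 1)) has_sum v + w) UNIV"
proof -
  define f where "f d = square_sign d * x powi (d\<^sup>2)" for d
  have split: "70 * (d div 70) + b = d" if "d mod 70 = b" for b d :: int
    using that by auto
  have "(f has_sum v) {d. d mod 70 = 1}"
    by (subst has_sum_reindex_bij_witness[of _ "\<lambda>j. 70 * j + 1" "\<lambda>d. d div 70" UNIV])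
      (use assms(1) in \<open>auto simp: f_def split\<close>)
  moreover have "(f has_sum w) {d. d mod 70 = 41}"
    by (subst has_sum_reindex_bij_witness[of _ "\<lambda>j. 70 * j + 41" "\<lambda>d. d div 70" UNIV])
      (use assms(2) in \<open>auto simp: f_def split\<close>)
  ultimately have "(f has_sum v + w) ({d. d mod 70 = 1} \<union> {d. d mod 70 = 41})"
    by (rule has_sum_Un_disjoint) auto
  \<comment> \<open>Multiples of 3 may be left out because \<open>square_sign\<close> vanishes
    there.\<close>
  then have "(f has_sum v + w) {d. (d mod 70 = 1 \<or> d mod 70 = 41) \<and> \<not> 3 dvd d}"
    by (rule has_sum_cong_neutral[THEN iffD1, rotated 3]) (auto simp: f_def square_sign_def)
  then have "((\<lambda>n. f (signed_square_root n)) has_sum v + w) UNIV"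
    by (simp add: has_sum_reindex_bij_betw[OF bij_betw_signed_square_root])
  moreover have "f (signed_square_root n) = (-1) ^ ((n + 4) div 8) * x ^ (840 * square_index_seq n + 1)" for n
  proof -
    have "(signed_square_root n)\<^sup>2 = int (840 * square_index_seq n + 1)"
      unfolding square_root_square[symmetric] by (simp add: signed_square_root_def)
    then show ?thesis
      by (simp only: f_def square_sign_signed_square_root power_int_of_nat)
  qed
  ultimately show ?thesis
    by simp
qed

lemma qpoch_inf_0 [simp]: "qpoch_inf 0 q = 1"
  by (simp add: qpoch_inf_def)

theorem theorem5:
  fixes q :: complex
  assumes "norm q < 1"
  shows "(\<lambda>n. (-1) ^ ((n + 4) div 8) * q ^ square_index_seq n) sums
    (qpochs_inf [q ^ 3, q ^ 4, q ^ 7] (q ^ 7) / qpochs_inf [q, q ^ 4] (q ^ 5))"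
proof (cases "q = 0")
  case True
  \<comment> \<open>The triple product needs a nonzero base, so \<open>q = 0\<close> is treated
    directly: as \<open>0 ^ 0 = 1\<close>, only the term \<open>n = 0\<close> survives.\<close>
  have idx: "square_index_seq n = 0 \<longleftrightarrow> n = 0" for n
  proof -
    have "square_index_seq n = 0 \<longleftrightarrow> (square_root n)\<^sup>2 = (square_root 0)\<^sup>2"
      unfolding square_root_square[of n] by (simp add: square_root_def square_root_residues_def)
    also have "\<dots> \<longleftrightarrow> n = 0"
      using strict_mono_square_root by (simp add: strict_mono_eq)
    finally show ?thesis .
  qed
  have "(-1) ^ ((n + 4) div 8) * q ^ square_index_seq n = (if n = 0 then 1 else 0)" for n
    by (cases "n = 0") (simp_all add: True power_0_left idx)
  moreover have "(\<lambda>n::nat. if n = 0 then 1 else 0 :: complex) sums 1"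
    using sums_single[of 0 "\<lambda>_. 1 :: complex"] by simp
  ultimately show ?thesis
    by (simp add: True qpochs_inf_def)
next
  case False
  \<comment> \<open>An 840th root of \<open>q\<close>, taken through the principal
    logarithm.\<close>
  define x where "x = exp (Ln q / 840)"
  have q: "q = x ^ 840"
    using False exp_of_nat_mult[of 840 "Ln q / 840"] by (simp add: x_def)
  have x0: "x \<noteq> 0"
    by (simp add: x_def)
  have x1: "norm x < 1"
  proof (rule ccontr)
    assume "\<not> norm x < 1"
    then have "norm x ^ 840 \<ge> 1"
      by (intro one_le_power) simp
    then show False
      using assms by (simp add: q norm_power)
  qed
  define v where "v b = (\<Sum>\<^sub>\<infinity>j. square_sign (70 * j + b) * x powi ((70 * j + b)\<^sup>2))" for b
  have v: "((\<lambda>j. square_sign (70 * j + b) * x powi ((70 * j + b)\<^sup>2)) has_sum v b) UNIV" for b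
  proof -
    have "(\<lambda>d. x powi (d\<^sup>2)) summable_on range (\<lambda>j. 70 * j + b)"
      by (rule summable_powi_square[OF x0 x1])
    then have "(\<lambda>j. x powi ((70 * j + b)\<^sup>2)) summable_on UNIV"
      by (subst (asm) summable_on_reindex) (auto simp: inj_on_def o_def)
    then have "(\<lambda>j. norm (x powi ((70 * j + b)\<^sup>2))) summable_on UNIV"
      by (simp add: summable_on_iff_abs_summable_on_complex)
    then have "(\<lambda>j. norm (square_sign (70 * j + b) * x powi ((70 * j + b)\<^sup>2))) summable_on UNIV"
      by (rule Infinite_Sum.abs_summable_on_comparison_test')
        (auto simp: square_sign_def norm_mult minus_one_powi)
    then show ?thesis
      unfolding v_def by (rule has_sum_infsum[OF abs_summable_summable])
  qed
  define R5 R7 where "R5 = qpochs_inf [q ^ 2, q ^ 3, q ^ 5] (q ^ 5)"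
    and "R7 = qpochs_inf [q ^ 3, q ^ 4, q ^ 7] (q ^ 7)"
  have "x ^ 21 * R5 * (x ^ 15 * R7) = x ^ 35 * qpoch_inf q q * (v 1 + v 41)"
    unfolding R5_def R7_def q
    by (rule theta5_theta7_eq[OF x0 x1 has_sum_theta5[OF x0 x1] has_sum_theta7[OF x0 x1]
          has_sum_euler_pentagonal[OF x0 x1] v v])
  \<comment> \<open>Since \<open>21 + 15 = 35 + 1\<close>, one \<open>x\<close> is left over; it
    matches the \<open>+ 1\<close> in the exponents
    \<open>840 * square_index_seq n + 1\<close>.\<close>
  moreover have "x ^ 21 * R5 * (x ^ 15 * R7) = x ^ 35 * (x * (R5 * R7))"
    by (simp add: eval_nat_numeral mult_ac)
  ultimately have "x * (R5 * R7) = qpoch_inf q q * (v 1 + v 41)"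
    using x0 by (simp add: mult.assoc)
  also have "qpoch_inf q q = qpochs_inf [q, q ^ 4] (q ^ 5) * R5"
    unfolding R5_def by (rule qpoch_inf_split_5[OF assms])
  finally have eq: "R5 * (x * R7) = R5 * (qpochs_inf [q, q ^ 4] (q ^ 5) * (v 1 + v 41))"
    by (simp add: mult_ac)
  \<comment> \<open>Nonvanishing of \<open>qpoch_inf q q\<close> gives both the cancellation of
    \<open>R5\<close> and the nonzero denominator.\<close>
  have nz: "qpochs_inf [q, q ^ 4] (q ^ 5) * R5 \<noteq> 0"
    using qpoch_inf_nonzero[OF assms assms] qpoch_inf_split_5[OF assms] unfolding R5_def by metis
  then have "x * R7 = qpochs_inf [q, q ^ 4] (q ^ 5) * (v 1 + v 41)"
    using eq by simp
  then have "(v 1 + v 41) / x = R7 / qpochs_inf [q, q ^ 4] (q ^ 5)"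
    using x0 nz by (simp add: frac_eq_eq mult.commute)
  moreover have "((\<lambda>n. (-1) ^ ((n + 4) div 8) * x ^ (840 * square_index_seq n + 1) / x) has_sum
      (v 1 + v 41) / x) UNIV"
    by (intro has_sum_divide_const has_sum_signed_squares v)
  then have "((\<lambda>n. (-1) ^ ((n + 4) div 8) * q ^ square_index_seq n) has_sum (v 1 + v 41) / x) UNIV"
    using x0 by (simp add: q power_mult)
  ultimately show ?thesis
    unfolding R7_def using has_sum_imp_sums by metis
qed

end
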